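(* The characteristic $\mathrm{char}$ is an $(\mathbb N_\infty^*,\mathrm{lcm})$-valued dimension on each of the categories $\mathrm{Ring}_n$, $\mathrm{Ring}_1$ and $\mathrm{Ring}_u$.
   Context: $\mathrm{Ring}_n$ is the category of all rings (possibly without unit) and all ring homomorphisms (maps preserving zero, addition and multiplication). $\mathrm{Ring}_1$ is its full subcategory on the rings having a unit element (morphisms need not preserve the unit). $\mathrm{Ring}_u$ is the subcategory of $\mathrm{Ring}_1$ with the same objects and only the unit-preserving homomorphisms. $\mathbb N^*_\infty=\{1,2,3,\dots\}\cup\{\infty\}$, with commutative monoid operation $\mathrm{lcm}$: the usual least common multiple on positive integers, and $\mathrm{lcm}(a,\infty)=\mathrm{lcm}(\infty,b)=\infty$; the neutral element is $1$. For a ring $R$, $\mathrm{char}(R)=\min\{n\in\mathbb N\setminus\{0\}: n\cdot x=0\ \text{for all }x\in R\}$, and $\mathrm{char}(R)=\infty$ if there is no such $n$. $M$-valued dimension. Let $M$ be a commutative monoid, written additively, and $\mathbb X$ a category; $\pi_0(\mathbb X)$ denotes the collection of isomorphism classes of objects of $\mathbb X$. An $M$-valued dimension on $\mathbb X$ is a function $\dim:\pi_0(\mathbb X)\to M$ such that for every pullback $A\times_B C$ in $\mathbb X$ of a morphism $f:C\to B$ along a retraction (split epimorphism in $\mathbb X$) $r:A\to B$, if $f$ is a retraction or $f$ is a section (split monomorphism), then $\dim(A\times_B C)+\dim(B)=\dim(A)+\dim(C)$. Here "$+$" is $\mathrm{lcm}$, so the condition reads $\mathrm{lcm}(\mathrm{char}(A\times_B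 C),\mathrm{char}(B))=\mathrm{lcm}(\mathrm{char}(A),\mathrm{char}(C))$. *)

theory Defs
  imports "HOL-Algebra.Ring" "HOL-Library.Extended_Nat" "HOL-Library.FuncSet"
begin

section \<open>Categories, pullbacks and dimensions\<close>

text \<open>
  Morphisms are indexed by their domain and codomain: the sets \<open>Mor X A B\<close> need not be disjoint,
  and \<open>Comp X A B C g f\<close> is the composite of \<open>f \<in> Mor X A B\<close> with \<open>g \<in> Mor X B C\<close>.
\<close>

record ('o, 'm) category =
  Ob :: "'o set"
  Mor :: "'o \<Rightarrow> 'o \<Rightarrow> 'm set"
  Idt :: "'o \<Rightarrow> 'm"
  Comp :: "'o \<Rightarrow> 'o \<Rightarrow> 'o \<Rightarrow> 'm \<Rightarrow> 'm \<Rightarrow> 'm"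

locale category =
  fixes X :: "('o, 'm) category"
  assumes Idt_closed: "A \<in> Ob X \<Longrightarrow> Idt X A \<in> Mor X A A"
    and Comp_closed:
      "\<lbrakk>A \<in> Ob X; B \<in> Ob X; C \<in> Ob X; f \<in> Mor X A B; g \<in> Mor X B C\<rbrakk>
        \<Longrightarrow> Comp X A B C g f \<in> Mor X A C"
    and Comp_Idt_right:
      "\<lbrakk>A \<in> Ob X; B \<in> Ob X; f \<in> Mor X A B\<rbrakk> \<Longrightarrow> Comp X A A B f (Idt X A) = f"
    and Comp_Idt_left:
      "\<lbrakk>A \<in> Ob X; B \<in> Ob X; f \<in> Mor X A B\<rbrakk> \<Longrightarrow> Comp X A B B (Idt X B) f = f"
    and Comp_assoc:
      "\<lbrakk>A \<in> Ob X; B \<in> Ob X; C \<in> Ob X; D \<in> Ob X;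
        f \<in> Mor X A B; g \<in> Mor X B C; h \<in> Mor X C D\<rbrakk>
        \<Longrightarrow> Comp X A C D h (Comp X A B C g f) = Comp X A B D (Comp X B C D h g) f"

definition isomorphic :: "('o, 'm) category \<Rightarrow> 'o \<Rightarrow> 'o \<Rightarrow> bool" where
  "isomorphic X A B \<longleftrightarrow>
    (\<exists>f \<in> Mor X A B. \<exists>g \<in> Mor X B A.
      Comp X A B A g f = Idt X A \<and> Comp X B A B f g = Idt X B)"

definition iso_rel :: "('o, 'm) category \<Rightarrow> ('o \<times> 'o) set" where
  "iso_rel X = {(A, B). A \<in> Ob X \<and> B \<in> Ob X \<and> isomorphic X A B}"

definition retraction :: "('o, 'm) category \<Rightarrow> 'o \<Rightarrow> 'o \<Rightarrow> 'm \<Rightarrow> bool" where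
  "retraction X A B r \<longleftrightarrow>
    r \<in> Mor X A B \<and> (\<exists>s \<in> Mor X B A. Comp X B A B r s = Idt X B)"

definition coretraction :: "('o, 'm) category \<Rightarrow> 'o \<Rightarrow> 'o \<Rightarrow> 'm \<Rightarrow> bool" where
  "coretraction X A B s \<longleftrightarrow>
    s \<in> Mor X A B \<and> (\<exists>r \<in> Mor X B A. Comp X A B A r s = Idt X A)"

text \<open>
  \<open>is_pullback X A B C r f P p q\<close>: the object \<open>P\<close> with projections \<open>p : P \<rightarrow> A\<close> and
  \<open>q : P \<rightarrow> C\<close> is a pullback of \<open>r : A \<rightarrow> B\<close> and \<open>f : C \<rightarrow> B\<close>.
\<close>

definition is_pullback ::
    "('o, 'm) category \<Rightarrow> 'o \<Rightarrow> 'o \<Rightarrow> 'o \<Rightarrow> 'm \<Rightarrow> 'm \<Rightarrow> 'o \<Rightarrow> 'm \<Rightarrow> 'm \<Rightarrow> bool" where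
  "is_pullback X A B C r f P p q \<longleftrightarrow>
    A \<in> Ob X \<and> B \<in> Ob X \<and> C \<in> Ob X \<and> r \<in> Mor X A B \<and> f \<in> Mor X C B \<and>
    P \<in> Ob X \<and> p \<in> Mor X P A \<and> q \<in> Mor X P C \<and>
    Comp X P A B r p = Comp X P C B f q \<and>
    (\<forall>Q \<in> Ob X. \<forall>h \<in> Mor X Q A. \<forall>k \<in> Mor X Q C.
      Comp X Q A B r h = Comp X Q C B f k \<longrightarrow>
      (\<exists>!u. u \<in> Mor X Q P \<and> Comp X Q P A p u = h \<and> Comp X Q P C q u = k))"

text \<open>
  A function on isomorphism classes of objects is given as a function \<open>d\<close> on objects that
  respects isomorphism. The monoid operation is written \<open>\<otimes>\<close>, as usual for monoid records.
\<close>

locale valued_dimension =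
  M: comm_monoid M + X: category X
  for M :: "'v monoid" (structure) and X :: "('o, 'm) category" +
  fixes d :: "'o \<Rightarrow> 'v"
  assumes dim_closed: "d \<in> Ob X \<rightarrow> carrier M"
    and dim_respects_iso: "d respects (iso_rel X)"
    and dim_pullback:
      "\<lbrakk>is_pullback X A B C r f P p q; retraction X A B r;
        retraction X C B f \<or> coretraction X C B f\<rbrakk>
        \<Longrightarrow> d P \<otimes> d B = d A \<otimes> d C"


section \<open>The monoid of positive integers and infinity under lcm\<close>

definition lcm_enat :: "enat \<Rightarrow> enat \<Rightarrow> enat" where
  "lcm_enat a b =
    (case a of enat m \<Rightarrow> (case b of enat n \<Rightarrow> enat (lcm m n) | \<infinity> \<Rightarrow> \<infinity>) | \<infinity> \<Rightarrow> \<infinity>)"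

definition lcm_monoid :: "enat monoid" where
  "lcm_monoid = \<lparr>carrier = {n. n \<noteq> 0}, mult = lcm_enat, one = 1\<rparr>"


section \<open>Categories of rings\<close>

text \<open>
  A ring possibly without unit is an \<open>'a ring\<close> record whose field \<open>one\<close> is ignored.
\<close>

locale rng = abelian_group R for R :: "'a ring" (structure) +
  assumes rng_m_closed: "\<lbrakk>x \<in> carrier R; y \<in> carrier R\<rbrakk> \<Longrightarrow> x \<otimes> y \<in> carrier R"
    and rng_m_assoc:
      "\<lbrakk>x \<in> carrier R; y \<in> carrier R; z \<in> carrier R\<rbrakk> \<Longrightarrow> (x \<otimes> y) \<otimes> z = x \<otimes> (y \<otimes> z)"
    and rng_l_distr:
      "\<lbrakk>x \<in> carrier R; y \<in> carrier R; z \<in> carrier R\<rbrakk> \<Longrightarrow> (x \<oplus> y) \<otimes> z = x \<otimes> z \<oplus> y \<otimes> z"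
    and rng_r_distr:
      "\<lbrakk>x \<in> carrier R; y \<in> carrier R; z \<in> carrier R\<rbrakk> \<Longrightarrow> z \<otimes> (x \<oplus> y) = z \<otimes> x \<oplus> z \<otimes> y"

definition rng_hom :: "'a ring \<Rightarrow> 'a ring \<Rightarrow> ('a \<Rightarrow> 'a) set" where
  "rng_hom R S = {h \<in> carrier R \<rightarrow> carrier S.
    h \<zero>\<^bsub>R\<^esub> = \<zero>\<^bsub>S\<^esub> \<and>
    (\<forall>x \<in> carrier R. \<forall>y \<in> carrier R.
      h (x \<oplus>\<^bsub>R\<^esub> y) = h x \<oplus>\<^bsub>S\<^esub> h y \<and> h (x \<otimes>\<^bsub>R\<^esub> y) = h x \<otimes>\<^bsub>S\<^esub> h y)}"

text \<open>
  The type \<open>'a\<close> plays the role of the universe: the objects are the rings whose carrier is a subset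
  of \<open>'a\<close>. Homomorphisms are extensional, so that equality of morphisms is equality on the carrier
  of the domain.
\<close>

definition Ring_n :: "('a ring, 'a \<Rightarrow> 'a) category" where
  "Ring_n = \<lparr>
    Ob = {R. rng R},
    Mor = (\<lambda>R S. rng_hom R S \<inter> extensional (carrier R)),
    Idt = (\<lambda>R. \<lambda>x \<in> carrier R. x),
    Comp = (\<lambda>R S T g f. compose (carrier R) g f)\<rparr>"

text \<open>
  A ring having a unit is represented by the record whose field \<open>one\<close> is that unit; see
  \<open>rng_with_unit_ring\<close> and \<open>rng_isomorphic_one_update\<close> below.
\<close>

definition Ring_1 :: "('a ring, 'a \<Rightarrow> 'a) category" where
  "Ring_1 = Ring_n \<lparr>Ob := {R. ring R}\<rparr>"

definition Ring_u :: "('a ring, 'a \<Rightarrow> 'a) category" where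
  "Ring_u = Ring_1 \<lparr>Mor := (\<lambda>R S. Mor Ring_1 R S \<inter> ring_hom R S)\<rparr>"

lemma ring_imp_rng: "ring R \<Longrightarrow> rng R"
  by (simp add: rng_def rng_axioms_def ring.is_abelian_group ring.ring_simprules)

lemma rng_with_unit_ring:
  assumes "rng R" and "u \<in> carrier R"
    and "\<And>x. x \<in> carrier R \<Longrightarrow> u \<otimes>\<^bsub>R\<^esub> x = x \<and> x \<otimes>\<^bsub>R\<^esub> u = x"
  shows "ring (R\<lparr>one := u\<rparr>)"
proof -
  interpret rng R by fact
  show ?thesis
    by (rule ringI, rule abelian_groupI, rule_tac [7] monoidI)
      (use assms in \<open>auto simp: a_assoc a_comm a_lcomm rng_m_closed rng_m_assoc rng_l_distr rng_r_distr
        intro: l_neg\<close>)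
qed

lemma rng_one_update:
  assumes "rng R" shows "rng (R\<lparr>one := u\<rparr>)"
proof -
  interpret rng R by fact
  show ?thesis
    by (rule rng.intro, rule abelian_groupI)
      (auto simp: rng_axioms_def a_assoc a_comm a_lcomm rng_m_closed rng_m_assoc rng_l_distr
        rng_r_distr intro: l_neg)
qed

lemma rng_isomorphic_one_update:
  assumes "rng R" shows "(R, R\<lparr>one := u\<rparr>) \<in> iso_rel Ring_n"
proof -
  interpret rng R by fact
  show ?thesis
    using assms rng_one_update[OF assms, of u]
    by (auto simp: iso_rel_def isomorphic_def Ring_n_def rng_hom_def compose_def rng_m_closed
        intro!: bexI[where x = "\<lambda>x \<in> carrier R. x"])
qed

definition ring_char :: "'a ring \<Rightarrow> enat" where
  "ring_char R =
    (if \<exists>n::nat. n \<noteq> 0 \<and> (\<forall>x \<in> carrier R. [n] \<cdot>\<^bsub>R\<^esub> x = \<zero>\<^bsub>R\<^esub>)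
     then enat (LEAST n. n \<noteq> 0 \<and> (\<forall>x \<in> carrier R. [n] \<cdot>\<^bsub>R\<^esub> x = \<zero>\<^bsub>R\<^esub>))
     else \<infinity>)"

end

(* An integer n kills R iff char R divides n, so the equation of lcms says that n kills P and B iff it
   kills A and C. The two projections of a pullback are jointly injective, so whatever kills A and C
   kills P. If f is a retraction, then A and C are retracts of P. If f is a section, then C is a
   retract of B, P embeds into A, and the characteristic of A is the lcm of those of B and the kernel
   of r (in Ring_1: a corner ring inside the kernel), which maps
   injectively to P. In Ring_u all four characteristics agree. *)
theory Submission
  imports Defs
begin

section \<open>Annihilating integers and the characteristic\<close>

definition annihilates :: "nat \<Rightarrow> 'a ring \<Rightarrow> bool" where
  "annihilates n R \<longleftrightarrow> (\<forall>x \<in> carrier R. [n] \<cdot>\<^bsub>R\<^esub> x = \<zero>\<^bsub>R\<^esub>)"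

text \<open>An equivalence allows a multiple of \<open>m\<close> to be cancelled from an
  annihilating integer, without the truncated subtraction of natural numbers.\<close>

lemma (in rng) annihilates_add:
  assumes "annihilates m R" shows "annihilates (m + n) R \<longleftrightarrow> annihilates n R"
  unfolding annihilates_def
proof (rule ball_cong[OF refl])
  fix x assume x: "x \<in> carrier R"
  have "[(m + n)] \<cdot>\<^bsub>R\<^esub> x = [m] \<cdot>\<^bsub>R\<^esub> x \<oplus> [n] \<cdot>\<^bsub>R\<^esub> x"
    using x by (simp add: add.nat_pow_mult)
  then show "[(m + n)] \<cdot>\<^bsub>R\<^esub> x = \<zero> \<longleftrightarrow> [n] \<cdot>\<^bsub>R\<^esub> x = \<zero>"
    using x assms by (simp add: annihilates_def)
qed

lemma (in rng) annihilates_mult: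
  assumes "annihilates m R" shows "annihilates (m * k) R"
  unfolding annihilates_def
proof
  fix x assume x: "x \<in> carrier R"
  have "[(m * k)] \<cdot>\<^bsub>R\<^esub> x = [k] \<cdot>\<^bsub>R\<^esub> ([m] \<cdot>\<^bsub>R\<^esub> x)"
    using x by (simp add: add.nat_pow_pow mult.commute)
  then show "[(m * k)] \<cdot>\<^bsub>R\<^esub> x = \<zero>"
    using x assms by (simp add: annihilates_def)
qed

text \<open>By Euclidean division, the part \<open>m * (n div m)\<close> of \<open>n\<close>
  cancels.\<close>

lemma (in rng) annihilates_mod:
  assumes "annihilates m R" "annihilates n R" shows "annihilates (n mod m) R"
  using annihilates_add[OF annihilates_mult[OF assms(1), of "n div m"], of "n mod m"] assms(2)
  by simp

text \<open>Here \<open>\<infinity>\<close> acts like \<open>0\<close>, the generator of the zero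
  ideal: a ring of infinite characteristic is killed by \<open>0\<close> alone.\<close>

definition dvd_enat :: "enat \<Rightarrow> nat \<Rightarrow> bool" where
  "dvd_enat e n \<longleftrightarrow> (case e of enat m \<Rightarrow> m dvd n | \<infinity> \<Rightarrow> n = 0)"

text \<open>Both \<open>\<infinity>\<close> in \<open>lcm_enat\<close> and \<open>0\<close> in
  \<open>lcm\<close> are absorbing, so the universal property of lcm survives the identification of
  \<open>\<infinity>\<close> with \<open>0\<close>.\<close>

lemma dvd_enat_lcm: "dvd_enat (lcm_enat a b) n \<longleftrightarrow> dvd_enat a n \<and> dvd_enat b n"
  by (auto simp: dvd_enat_def lcm_enat_def split: enat.splits)

text \<open>Nonzero arguments are needed: both \<open>0\<close> and \<open>\<infinity>\<close> divide \<open>0\<close> only.\<close>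

lemma dvd_enat_inject:
  assumes "a \<noteq> 0" "b \<noteq> 0" and eq: "\<And>n. dvd_enat a n \<longleftrightarrow> dvd_enat b n"
  shows "a = b"
proof (cases a; cases b)
  fix m n assume "a = enat m" "b = enat n"
  then show ?thesis using eq[of m] eq[of n] by (auto simp: dvd_enat_def intro: dvd_antisym)
next
  fix m assume "a = enat m" "b = \<infinity>"
  then show ?thesis using eq[of m] assms(1) by (auto simp: dvd_enat_def zero_enat_def)
next
  fix n assume "a = \<infinity>" "b = enat n"
  then show ?thesis using eq[of n] assms(2) by (auto simp: dvd_enat_def zero_enat_def)
qed simp

lemma lcm_enat_nonzero: "a \<noteq> 0 \<Longrightarrow> b \<noteq> 0 \<Longrightarrow> lcm_enat a b \<noteq> 0"
  by (auto simp: lcm_enat_def zero_enat_def split: enat.splits)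

lemma comm_monoid_lcm_monoid: "comm_monoid lcm_monoid"
  by (rule comm_monoidI)
    (auto simp: lcm_monoid_def lcm_enat_nonzero lcm_enat_def zero_enat_def one_enat_def
      lcm.assoc lcm.commute lcm.left_commute split: enat.splits)

section \<open>The characteristic as generator of the annihilating integers\<close>

lemma ring_char_nonzero: "ring_char R \<noteq> 0"
proof (cases "\<exists>n::nat. n \<noteq> 0 \<and> annihilates n R")
  case True
  from LeastI_ex[OF this] show ?thesis
    by (auto simp: ring_char_def zero_enat_def annihilates_def)
qed (metis annihilates_def infinity_ne_i0 ring_char_def)

text \<open>A remainder modulo the least positive annihilating integer annihilates again, so
  minimality forces it to be zero.\<close>

lemma dvd_ring_char:
  assumes "rng R" shows "dvd_enat (ring_char R) n \<longleftrightarrow> annihilates n R"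
proof (cases "\<exists>n::nat. n \<noteq> 0 \<and> annihilates n R")
  case True
  define m where "m = (LEAST n. n \<noteq> 0 \<and> annihilates n R)"
  have m: "m \<noteq> 0" "annihilates m R" using LeastI_ex[OF True] by (auto simp: m_def)
  have char: "ring_char R = enat m"
    using True by (simp add: ring_char_def m_def annihilates_def)
  have "m dvd n" if "annihilates n R"
  proof (rule ccontr)
    assume "\<not> m dvd n"
    then have "n mod m \<noteq> 0 \<and> annihilates (n mod m) R"
      using rng.annihilates_mod[OF assms m(2) that] by (simp add: dvd_eq_mod_eq_0)
    then have "m \<le> n mod m" unfolding m_def by (rule Least_le)
    then show False using m(1) by (metis mod_less_divisor leD neq0_conv)
  qed
  then show ?thesis
    using rng.annihilates_mult[OF assms m(2)] by (auto simp: char dvd_enat_def)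
next
  case False
  then have "ring_char R = \<infinity>" by (simp add: ring_char_def annihilates_def)
  \<comment> \<open>The integer \<open>0\<close> always annihilates, in agreement with
    \<open>\<infinity>\<close> dividing \<open>0\<close>.\<close>
  moreover have "annihilates 0 R"
    using assms by (simp add: annihilates_def add_pow_def)
  ultimately show ?thesis using False by (auto simp: dvd_enat_def)
qed

lemma ring_char_eqI:
  assumes "rng R" "rng S" "\<And>n. annihilates n R \<longleftrightarrow> annihilates n S"
  shows "ring_char R = ring_char S"
  by (rule dvd_enat_inject) (simp_all add: ring_char_nonzero dvd_ring_char assms)

lemma lcm_ring_char_eqI:
  assumes "rng P" "rng B" "rng A" "rng C"
    and "\<And>n. annihilates n P \<and> annihilates n B \<longleftrightarrow> annihilates n A \<and> annihilates n C"
  shows "lcm_enat (ring_char P) (ring_char B) = lcm_enat (ring_char A) (ring_char C)"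
  by (rule dvd_enat_inject)
    (simp_all add: ring_char_nonzero lcm_enat_nonzero dvd_enat_lcm dvd_ring_char assms)


section \<open>Homomorphisms of rings without unit\<close>

lemma rng_hom_closed: "h \<in> rng_hom R S \<Longrightarrow> x \<in> carrier R \<Longrightarrow> h x \<in> carrier S"
  and rng_hom_zero: "h \<in> rng_hom R S \<Longrightarrow> h \<zero>\<^bsub>R\<^esub> = \<zero>\<^bsub>S\<^esub>"
  and rng_hom_add: "h \<in> rng_hom R S \<Longrightarrow> x \<in> carrier R \<Longrightarrow> y \<in> carrier R
    \<Longrightarrow> h (x \<oplus>\<^bsub>R\<^esub> y) = h x \<oplus>\<^bsub>S\<^esub> h y"
  and rng_hom_mult: "h \<in> rng_hom R S \<Longrightarrow> x \<in> carrier R \<Longrightarrow> y \<in> carrier R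
    \<Longrightarrow> h (x \<otimes>\<^bsub>R\<^esub> y) = h x \<otimes>\<^bsub>S\<^esub> h y"
  by (auto simp: rng_hom_def)

lemmas rng_hom_simps = rng_hom_closed rng_hom_zero rng_hom_add rng_hom_mult

lemma rng_abelian_group: "rng R \<Longrightarrow> abelian_group R"
  by (simp add: rng_def)

lemmas rng_closed =
  abelian_monoid.zero_closed[OF abelian_group.axioms(1)[OF rng_abelian_group]]
  abelian_monoid.a_closed[OF abelian_group.axioms(1)[OF rng_abelian_group]]
  rng.rng_m_closed

lemma rng_hom_compose:
  assumes "rng R" "g \<in> rng_hom S T" "f \<in> rng_hom R S"
  shows "compose (carrier R) g f \<in> rng_hom R T"
  using assms by (auto simp: rng_hom_def compose_eq rng_closed Pi_iff compose_def)

lemma rng_hom_id: "rng R \<Longrightarrow> (\<lambda>x \<in> carrier R. x) \<in> rng_hom R R"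
  by (auto simp: rng_hom_def rng_closed)

text \<open>Supplies the leg into \<open>C\<close> of the cone on the kernel ring in the section
  case. It is a morphism of \<open>Ring_1\<close> as well, since units need not be preserved
  there.\<close>

lemma rng_hom_trivial: "rng R \<Longrightarrow> rng S \<Longrightarrow> (\<lambda>x \<in> carrier R. \<zero>\<^bsub>S\<^esub>) \<in> rng_hom R S"
proof -
  assume R: "rng R" and S: "rng S"
  interpret S: rng S by fact
  \<comment> \<open>Expand \<open>(0 + 0) * 0\<close> by distributivity and cancel.\<close>
  have "\<zero>\<^bsub>S\<^esub> \<otimes>\<^bsub>S\<^esub> \<zero>\<^bsub>S\<^esub> = \<zero>\<^bsub>S\<^esub>"
    using S.rng_l_distr[of "\<zero>\<^bsub>S\<^esub>" "\<zero>\<^bsub>S\<^esub>" "\<zero>\<^bsub>S\<^esub>"]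
    by (simp add: S.rng_m_closed)
  then show ?thesis using R by (auto simp: rng_hom_def rng_closed)
qed

lemma rng_hom_add_pow:
  fixes n :: nat
  assumes "rng R" "h \<in> rng_hom R S" "x \<in> carrier R"
  shows "h ([n] \<cdot>\<^bsub>R\<^esub> x) = [n] \<cdot>\<^bsub>S\<^esub> h x"
proof -
  interpret R: rng R by fact
  show ?thesis
  proof (induction n)
    case 0
    show ?case by (simp add: add_pow_def rng_hom_zero[OF assms(2)])
  next
    case (Suc n)
    have "h ([n] \<cdot>\<^bsub>R\<^esub> x \<oplus>\<^bsub>R\<^esub> x) = h ([n] \<cdot>\<^bsub>R\<^esub> x) \<oplus>\<^bsub>S\<^esub> h x"
      using assms(3) by (intro rng_hom_add[OF assms(2)]) auto
    then show ?case using Suc by (simp add: add_pow_def)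
  qed
qed

lemma annihilates_inj:
  assumes "rng R" "h \<in> rng_hom R S" "inj_on h (carrier R)" "annihilates n S"
  shows "annihilates n R"
  unfolding annihilates_def
proof
  fix x assume x: "x \<in> carrier R"
  interpret R: rng R by fact
  have "h ([n] \<cdot>\<^bsub>R\<^esub> x) = h \<zero>\<^bsub>R\<^esub>"
    using assms(4) x rng_hom_closed[OF assms(2) x]
    by (simp add: rng_hom_add_pow[OF assms(1,2)] rng_hom_zero[OF assms(2)] annihilates_def)
  then show "[n] \<cdot>\<^bsub>R\<^esub> x = \<zero>\<^bsub>R\<^esub>"
    using assms(3) x by (auto dest: inj_onD)
qed

text \<open>The function \<open>g\<close> only serves to make \<open>h\<close> injective; in the
  applications it is a retraction or a pullback projection.\<close>

lemma annihilates_left_inverse: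
  assumes "rng R" "h \<in> rng_hom R S" "\<And>x. x \<in> carrier R \<Longrightarrow> g (h x) = x" "annihilates n S"
  shows "annihilates n R"
  by (rule annihilates_inj[OF assms(1,2) inj_on_inverseI assms(4)]) (rule assms(3))

text \<open>Stands in for an embedding of \<open>P\<close> into \<open>A \<times> C\<close>, whose
  carrier would live in another type.\<close>

lemma annihilates_joint_inj:
  assumes "rng P" "p \<in> rng_hom P A" "q \<in> rng_hom P C"
    and "\<And>x y. x \<in> carrier P \<Longrightarrow> y \<in> carrier P \<Longrightarrow> p x = p y \<Longrightarrow> q x = q y \<Longrightarrow> x = y"
    and "annihilates n A" "annihilates n C"
  shows "annihilates n P"
  unfolding annihilates_def
proof
  fix x assume x: "x \<in> carrier P"
  interpret P: rng P by fact
  note pq = assms(2,3)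
  show "[n] \<cdot>\<^bsub>P\<^esub> x = \<zero>\<^bsub>P\<^esub>"
    by (rule assms(4)) (use x assms(5,6) rng_hom_closed[OF pq(1) x] rng_hom_closed[OF pq(2) x] in
      \<open>simp_all add: rng_hom_add_pow[OF assms(1) pq(1)] rng_hom_add_pow[OF assms(1) pq(2)]
        rng_hom_zero[OF pq(1)] rng_hom_zero[OF pq(2)] annihilates_def\<close>)
qed

text \<open>Every element of \<open>Q\<close> is an image, so each ring law is carried over from
  \<open>P\<close>. This recognizes a quotient of \<open>P\<close> built on representatives as a
  ring.\<close>

lemma rng_image:
  assumes "rng P" and h: "h \<in> rng_hom P Q" and surj: "h ` carrier P = carrier Q"
  shows "rng Q"
proof -
  interpret P: rng P by fact
  \<comment> \<open>Oriented to pull \<open>h\<close> outwards, so that a law in \<open>Q\<close>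
    becomes \<open>h\<close> applied to a law in \<open>P\<close>.\<close>
  note [simp] = rng_hom_add[OF h, symmetric] rng_hom_mult[OF h, symmetric]
    rng_hom_zero[OF h, symmetric]
  have Q: "carrier Q = h ` carrier P" using surj by simp
  have "abelian_group Q"
    by (rule abelian_groupI)
      (auto simp: Q P.a_assoc P.a_comm P.a_lcomm P.r_neg
        intro!: bexI[OF _ P.a_inv_closed] arg_cong[of _ _ h])
  then show ?thesis
    by (rule rng.intro)
      (auto simp: rng_axioms_def Q P.rng_m_closed P.rng_m_assoc P.rng_l_distr P.rng_r_distr)
qed

lemma ring_image:
  assumes "ring P" and h: "h \<in> rng_hom P Q" and surj: "h ` carrier P = carrier Q"
    and one: "h \<one>\<^bsub>P\<^esub> = \<one>\<^bsub>Q\<^esub>"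
  shows "ring Q"
proof -
  interpret P: ring P by fact
  have "rng Q" using rng_image[OF ring_imp_rng h surj] assms(1) .
  moreover have "\<one>\<^bsub>Q\<^esub> \<in> carrier Q" using rng_hom_closed[OF h P.one_closed] one by simp
  moreover have "\<one>\<^bsub>Q\<^esub> \<otimes>\<^bsub>Q\<^esub> x = x \<and> x \<otimes>\<^bsub>Q\<^esub> \<one>\<^bsub>Q\<^esub> = x" if "x \<in> carrier Q" for x
    using that by (auto simp: surj[symmetric] one[symmetric] rng_hom_mult[OF h, symmetric])
  \<comment> \<open>Overwriting the unit of \<open>Q\<close> by itself leaves the record
    unchanged.\<close>
  ultimately have "ring (Q\<lparr>one := \<one>\<^bsub>Q\<^esub>\<rparr>)" by (rule rng_with_unit_ring)
  then show ?thesis by simp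
qed

lemma subrng_rng:
  assumes "rng A" "H \<subseteq> carrier A" "\<zero>\<^bsub>A\<^esub> \<in> H"
    and "\<And>x y. x \<in> H \<Longrightarrow> y \<in> H \<Longrightarrow> x \<oplus>\<^bsub>A\<^esub> y \<in> H"
    and "\<And>x. x \<in> H \<Longrightarrow> \<ominus>\<^bsub>A\<^esub> x \<in> H"
    and "\<And>x y. x \<in> H \<Longrightarrow> y \<in> H \<Longrightarrow> x \<otimes>\<^bsub>A\<^esub> y \<in> H"
  shows "rng (A\<lparr>carrier := H\<rparr>)"
proof -
  interpret A: rng A by fact
  have sub: "x \<in> carrier A" if "x \<in> H" for x using that assms(2) by auto
  have "abelian_group (A\<lparr>carrier := H\<rparr>)"
    by (rule abelian_groupI)
      (use assms(3-) in \<open>auto simp: sub A.a_assoc A.a_comm A.a_lcomm A.r_neg intro!: bexI[OF _ assms(5)]\<close>)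
  then show ?thesis
    by (rule rng.intro)
      (use assms(3-) in \<open>auto simp: rng_axioms_def sub A.rng_m_assoc A.rng_l_distr A.rng_r_distr\<close>)
qed


section \<open>Full subcategories of rings\<close>

text \<open>\<open>Ring_n\<close> and \<open>Ring_1\<close> differ only in their objects; with the
  objects as a parameter, one argument covers both.\<close>

definition full_rng :: "'a ring set \<Rightarrow> ('a ring, 'a \<Rightarrow> 'a) category" where
  "full_rng \<R> = Ring_n\<lparr>Ob := \<R>\<rparr>"

lemma full_rng_simps:
  "Ob (full_rng \<R>) = \<R>"
  "Mor (full_rng \<R>) R S = rng_hom R S \<inter> extensional (carrier R)"
  "Idt (full_rng \<R>) R = (\<lambda>x \<in> carrier R. x)"
  "Comp (full_rng \<R>) R S T g f = compose (carrier R) g f"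
  by (simp_all add: full_rng_def Ring_n_def)

lemma compose_eq_iff:
  "compose S g f = compose S k h \<longleftrightarrow> (\<forall>x \<in> S. g (f x) = k (h x))"
  by (auto simp: compose_def restrict_def fun_eq_iff)

lemma compose_eq_id_iff: "compose S g f = (\<lambda>x \<in> S. x) \<longleftrightarrow> (\<forall>x \<in> S. g (f x) = x)"
  by (auto simp: compose_def restrict_def fun_eq_iff)

lemma rng_hom_restrict:
  "rng R \<Longrightarrow> h \<in> rng_hom R S \<Longrightarrow> restrict h (carrier R) \<in> rng_hom R S"
  by (auto simp: rng_hom_def rng_closed)

text \<open>
  The kernel condition asks only for a subring killed by \<open>r\<close> that accounts for the part of the
  characteristic of \<open>A\<close> not visible in \<open>B\<close>; in the unital case the kernel of \<open>r\<close> need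
  not be an object.
\<close>

locale rng_full_subcategory =
  fixes \<R> :: "'a ring set"
  assumes rng: "R \<in> \<R> \<Longrightarrow> rng R"
    and image_closed:
      "\<lbrakk>R \<in> \<R>; h \<in> rng_hom R Q; h ` carrier R = carrier Q; h \<one>\<^bsub>R\<^esub> = \<one>\<^bsub>Q\<^esub>\<rbrakk> \<Longrightarrow> Q \<in> \<R>"
    and kernel:
      "\<lbrakk>A \<in> \<R>; B \<in> \<R>; r \<in> rng_hom A B; s \<in> rng_hom B A; \<And>x. x \<in> carrier B \<Longrightarrow> r (s x) = x\<rbrakk>
        \<Longrightarrow> \<exists>K \<in> \<R>. (\<lambda>x. x) \<in> rng_hom K A \<and> (\<forall>x \<in> carrier K. r x = \<zero>\<^bsub>B\<^esub>) \<and>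
              (\<forall>n. annihilates n K \<and> annihilates n B \<longrightarrow> annihilates n A)"
begin

lemma category_full_rng: "category (full_rng \<R>)"
proof
  fix A B C D and f g h :: "'a \<Rightarrow> 'a"
  assume "f \<in> Mor (full_rng \<R>) A B"
  then show "Comp (full_rng \<R>) A C D h (Comp (full_rng \<R>) A B C g f)
      = Comp (full_rng \<R>) A B D (Comp (full_rng \<R>) B C D h g) f"
    unfolding full_rng_simps by (intro compose_assoc) (auto simp: rng_hom_def)
next
  fix A B f
  assume "f \<in> Mor (full_rng \<R>) A B"
  then have f: "f \<in> rng_hom A B" "f \<in> extensional (carrier A)" by (auto simp: full_rng_simps)
  show "Comp (full_rng \<R>) A A B f (Idt (full_rng \<R>) A) = f"
    and "Comp (full_rng \<R>) A B B (Idt (full_rng \<R>) B) f = f"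
    unfolding full_rng_simps using rng_hom_closed[OF f(1)]
    by (auto intro!: extensionalityI[OF _ f(2)] simp: compose_eq)
qed (auto simp: full_rng_simps rng rng_hom_id intro: rng_hom_compose)

section \<open>Pullbacks read elementwise, and their annihilating integers\<close>

lemma pullback_full_rngD:
  assumes "is_pullback (full_rng \<R>) A B C r f P p q"
  shows "A \<in> \<R>" "B \<in> \<R>" "C \<in> \<R>" "P \<in> \<R>"
    and "r \<in> rng_hom A B" "f \<in> rng_hom C B" "p \<in> rng_hom P A" "q \<in> rng_hom P C"
    and "\<forall>x \<in> carrier P. r (p x) = f (q x)"
  using assms unfolding is_pullback_def full_rng_simps compose_eq_iff
  by - (elim conjE IntE, assumption)+

text \<open>Morphisms are extensional, so \<open>h\<close> and \<open>k\<close> are first restricted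
  to the carrier of \<open>Q\<close>; the resulting equations of composites are then evaluated
  pointwise.\<close>

lemma pullback_induced:
  assumes pb: "is_pullback (full_rng \<R>) A B C r f P p q" and Q: "Q \<in> \<R>"
    and h: "h \<in> rng_hom Q A" and k: "k \<in> rng_hom Q C"
    and eq: "\<And>x. x \<in> carrier Q \<Longrightarrow> r (h x) = f (k x)"
  obtains u where "u \<in> rng_hom Q P" "\<And>x. x \<in> carrier Q \<Longrightarrow> p (u x) = h x"
    "\<And>x. x \<in> carrier Q \<Longrightarrow> q (u x) = k x"
proof -
  let ?h = "restrict h (carrier Q)" and ?k = "restrict k (carrier Q)"
  have "?h \<in> Mor (full_rng \<R>) Q A" "?k \<in> Mor (full_rng \<R>) Q C"
    using h k rng[OF Q] by (auto simp: full_rng_simps rng_hom_restrict)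
  moreover have "compose (carrier Q) r ?h = compose (carrier Q) f ?k"
    using eq by (simp add: compose_eq_iff)
  ultimately obtain u where "u \<in> rng_hom Q P"
    "compose (carrier Q) p u = ?h" "compose (carrier Q) q u = ?k"
    using pb Q unfolding is_pullback_def full_rng_simps by blast
  moreover have "p (u x) = h x" "q (u x) = k x" if "x \<in> carrier Q" for x
    using fun_cong[OF calculation(2), of x] fun_cong[OF calculation(3), of x] that
    by (simp_all add: compose_eq)
  ultimately show ?thesis using that by blast
qed

lemma pullback_unique:
  assumes pb: "is_pullback (full_rng \<R>) A B C r f P p q" and Q: "Q \<in> \<R>"
    and u: "u \<in> rng_hom Q P" and v: "v \<in> rng_hom Q P"
    and p: "\<And>x. x \<in> carrier Q \<Longrightarrow> p (u x) = p (v x)"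
    and q: "\<And>x. x \<in> carrier Q \<Longrightarrow> q (u x) = q (v x)"
    and x: "x \<in> carrier Q"
  shows "u x = v x"
proof -
  let ?u = "restrict u (carrier Q)" and ?v = "restrict v (carrier Q)"
  \<comment> \<open>The cone is read off from \<open>u\<close>; by hypothesis \<open>v\<close>
    mediates for the same cone.\<close>
  let ?h = "compose (carrier Q) p u" and ?k = "compose (carrier Q) q u"
  have pq: "p \<in> rng_hom P A" "q \<in> rng_hom P C" "\<And>x. x \<in> carrier P \<Longrightarrow> r (p x) = f (q x)"
    using pullback_full_rngD[OF pb] by simp_all
  have "?h \<in> Mor (full_rng \<R>) Q A" "?k \<in> Mor (full_rng \<R>) Q C"
    using pq u rng[OF Q] by (auto simp: full_rng_simps rng_hom_compose)
  moreover have "compose (carrier Q) r ?h = compose (carrier Q) f ?k"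
    using pq(3) rng_hom_closed[OF u] by (simp add: compose_eq_iff compose_eq)
  ultimately have "\<exists>!w. w \<in> rng_hom Q P \<inter> extensional (carrier Q) \<and>
      compose (carrier Q) p w = ?h \<and> compose (carrier Q) q w = ?k"
    using pb Q unfolding is_pullback_def full_rng_simps by blast
  moreover have "?u \<in> rng_hom Q P \<inter> extensional (carrier Q) \<and>
      compose (carrier Q) p ?u = ?h \<and> compose (carrier Q) q ?u = ?k"
    using rng[OF Q] u by (auto simp: rng_hom_restrict compose_eq_iff)
  moreover have "?v \<in> rng_hom Q P \<inter> extensional (carrier Q) \<and>
      compose (carrier Q) p ?v = ?h \<and> compose (carrier Q) q ?v = ?k"
    using rng[OF Q] v p q by (auto simp: rng_hom_restrict compose_eq_iff)
  ultimately have "?u = ?v" by blast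
  then show ?thesis using x by (metis restrict_apply')
qed

text \<open>
  The carrier type may be finite, so the subring of \<open>A \<times> C\<close> need not be available as a test object.
  The quotient of \<open>P\<close> by the joint kernel of the projections is: it lives on a set of
  representatives \<open>\<rho> x\<close>. Both projections factor through it, so \<open>P\<close> is a retract of this quotient.
\<close>

lemma pullback_joint_inj:
  assumes pb: "is_pullback (full_rng \<R>) A B C r f P p q"
    and xy: "x \<in> carrier P" "y \<in> carrier P" "p x = p y" "q x = q y"
  shows "x = y"
proof -
  have P: "P \<in> \<R>" and p: "p \<in> rng_hom P A" and q: "q \<in> rng_hom P C"
    and comm: "\<And>x. x \<in> carrier P \<Longrightarrow> r (p x) = f (q x)"
    using pullback_full_rngD[OF pb] by simp_all
  \<comment> \<open>One representative is chosen in each joint fibre of \<open>p\<close> and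
    \<open>q\<close>. The choice depends on \<open>p x\<close> and \<open>q x\<close> alone, which
    yields \<open>\<rho>_cong\<close>.\<close>
  define \<rho> where "\<rho> x = (SOME y. y \<in> carrier P \<and> p y = p x \<and> q y = q x)" for x
  have \<rho>: "\<rho> x \<in> carrier P" "p (\<rho> x) = p x" "q (\<rho> x) = q x" if "x \<in> carrier P" for x
    using someI[of "\<lambda>y. y \<in> carrier P \<and> p y = p x \<and> q y = q x" x] that by (auto simp: \<rho>_def)
  have \<rho>_cong: "\<rho> x = \<rho> y" if "p x = p y" "q x = q y" for x y
    using that by (simp add: \<rho>_def)
  define Q :: "'a ring" where
    "Q = \<lparr>carrier = \<rho> ` carrier P, mult = (\<lambda>x y. \<rho> (x \<otimes>\<^bsub>P\<^esub> y)), one = \<rho> \<one>\<^bsub>P\<^esub>,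
          zero = \<rho> \<zero>\<^bsub>P\<^esub>, add = (\<lambda>x y. \<rho> (x \<oplus>\<^bsub>P\<^esub> y))\<rparr>"
  note closed = rng_closed[OF rng[OF P]]
  note p_simps = rng_hom_zero[OF p] rng_hom_add[OF p] rng_hom_mult[OF p]
  note q_simps = rng_hom_zero[OF q] rng_hom_add[OF q] rng_hom_mult[OF q]
  have \<rho>_hom: "\<rho> \<in> rng_hom P Q"
    by (auto simp: rng_hom_def Q_def closed \<rho> p_simps q_simps intro!: \<rho>_cong)
  have Q: "Q \<in> \<R>"
    using P \<rho>_hom by (rule image_closed) (simp_all add: Q_def)
  have pq_Q: "p \<in> rng_hom Q A" "q \<in> rng_hom Q C"
    by (auto simp: rng_hom_def Q_def closed \<rho> p_simps q_simps rng_hom_closed[OF p]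
        rng_hom_closed[OF q])
  have "r (p x) = f (q x)" if "x \<in> carrier Q" for x
    using that \<rho>(1) comm by (auto simp: Q_def)
  then obtain u where u: "u \<in> rng_hom Q P" "\<And>x. x \<in> carrier Q \<Longrightarrow> p (u x) = p x"
    "\<And>x. x \<in> carrier Q \<Longrightarrow> q (u x) = q x"
    by (rule pullback_induced[OF pb Q pq_Q])
      (assumption, rule that)
  \<comment> \<open>With \<open>P\<close> itself as test object, \<open>u\<close> after
    \<open>\<rho>\<close> and the identity have the same projections, so they agree. Hence
    \<open>x\<close> is recovered from \<open>\<rho> x\<close>.\<close>
  have u\<rho>: "compose (carrier P) u \<rho> x = (\<lambda>x \<in> carrier P. x) x" if "x \<in> carrier P" for x
    using pb P rng_hom_compose[OF rng[OF P] u(1) \<rho>_hom] rng_hom_id[OF rng[OF P]] _ _ that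
    by (rule pullback_unique) (simp_all add: compose_eq u \<rho> rng_hom_closed[OF \<rho>_hom])
  show ?thesis
    using u\<rho>[OF xy(1)] u\<rho>[OF xy(2)] xy(1,2) \<rho>_cong[OF xy(3,4)] by (simp add: compose_eq)
qed

text \<open>The pairs \<open>(id, t r)\<close> and \<open>(s f, id)\<close> are cones with vertices
  \<open>A\<close> and \<open>C\<close>; the maps they induce into \<open>P\<close> are sections of
  \<open>p\<close> and \<open>q\<close>.\<close>

lemma annihilates_pullback_retraction:
  assumes pb: "is_pullback (full_rng \<R>) A B C r f P p q"
    and s: "s \<in> rng_hom B A" "\<And>x. x \<in> carrier B \<Longrightarrow> r (s x) = x"
    and t: "t \<in> rng_hom B C" "\<And>x. x \<in> carrier B \<Longrightarrow> f (t x) = x"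
  shows "annihilates n P \<and> annihilates n B \<longleftrightarrow> annihilates n A \<and> annihilates n C"
proof -
  have Ob: "A \<in> \<R>" "B \<in> \<R>" "C \<in> \<R>" "P \<in> \<R>"
    and p: "p \<in> rng_hom P A" and q: "q \<in> rng_hom P C"
    and r: "r \<in> rng_hom A B" and f: "f \<in> rng_hom C B"
    using pullback_full_rngD[OF pb] by simp_all
  note rngs = Ob[THEN rng]
  have "r ((\<lambda>x \<in> carrier A. x) x) = f (compose (carrier A) t r x)" if "x \<in> carrier A" for x
    using that t(2) rng_hom_closed[OF r] by (simp add: compose_eq)
  then obtain a where a: "a \<in> rng_hom A P"
    "\<And>x. x \<in> carrier A \<Longrightarrow> p (a x) = (\<lambda>x \<in> carrier A. x) x"
    by (rule pullback_induced[OF pb Ob(1) rng_hom_id[OF rngs(1)] rng_hom_compose[OF rngs(1) t(1) r]])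
      (assumption, rule that)
  have "r (compose (carrier C) s f x) = f ((\<lambda>x \<in> carrier C. x) x)" if "x \<in> carrier C" for x
    using that s(2) rng_hom_closed[OF f] by (simp add: compose_eq)
  then obtain c where c: "c \<in> rng_hom C P"
    "\<And>x. x \<in> carrier C \<Longrightarrow> q (c x) = (\<lambda>x \<in> carrier C. x) x"
    by (rule pullback_induced[OF pb Ob(3) rng_hom_compose[OF rngs(3) s(1) f] rng_hom_id[OF rngs(3)]])
      (assumption, rule that)
  have "annihilates n A" if "annihilates n P"
    by (rule annihilates_left_inverse[OF rngs(1) a(1) _ that, of p]) (simp add: a(2))
  moreover have "annihilates n C" if "annihilates n P"
    by (rule annihilates_left_inverse[OF rngs(3) c(1) _ that, of q]) (simp add: c(2))
  moreover have "annihilates n B" if "annihilates n A"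
    by (rule annihilates_left_inverse[OF rngs(2) s that])
  moreover have "annihilates n P" if "annihilates n A" "annihilates n C"
    by (rule annihilates_joint_inj[OF rngs(4) p q pullback_joint_inj[OF pb] that])
  ultimately show ?thesis by blast
qed

text \<open>Injectivity of \<open>f\<close> makes \<open>p\<close> injective, which brings
  annihilation from \<open>A\<close> to \<open>P\<close>. The way back to \<open>A\<close> goes
  through the ring \<open>K\<close> given by \<open>kernel\<close>.\<close>

lemma annihilates_pullback_coretraction:
  assumes pb: "is_pullback (full_rng \<R>) A B C r f P p q"
    and s: "s \<in> rng_hom B A" "\<And>x. x \<in> carrier B \<Longrightarrow> r (s x) = x"
    and g: "\<And>x. x \<in> carrier C \<Longrightarrow> g (f x) = x"
  shows "annihilates n P \<and> annihilates n B \<longleftrightarrow> annihilates n A \<and> annihilates n C"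
proof -
  have Ob: "A \<in> \<R>" "B \<in> \<R>" "C \<in> \<R>" "P \<in> \<R>"
    and p: "p \<in> rng_hom P A" and q: "q \<in> rng_hom P C"
    and r: "r \<in> rng_hom A B" and f: "f \<in> rng_hom C B"
    and comm: "\<And>x. x \<in> carrier P \<Longrightarrow> r (p x) = f (q x)"
    using pullback_full_rngD[OF pb] by simp_all
  note rngs = Ob[THEN rng]
  have "inj_on p (carrier P)"
  proof (rule inj_onI)
    fix x y assume xy: "x \<in> carrier P" "y \<in> carrier P" "p x = p y"
    have "f (q x) = f (q y)"
      using comm[OF xy(1)] comm[OF xy(2)] xy(3) by metis
    then have "q x = q y"
      using g[OF rng_hom_closed[OF q xy(1)]] g[OF rng_hom_closed[OF q xy(2)]] by metis
    then show "x = y" by (rule pullback_joint_inj[OF pb xy])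
  qed
  then have "annihilates n P" if "annihilates n A"
    by (rule annihilates_inj[OF rngs(4) p _ that])
  moreover have "annihilates n B" if "annihilates n A"
    by (rule annihilates_left_inverse[OF rngs(2) s that])
  moreover have "annihilates n C" if "annihilates n B"
    by (rule annihilates_left_inverse[OF rngs(3) f g that])
  moreover have "annihilates n A" if "annihilates n P" "annihilates n B"
  proof -
    obtain K where K: "K \<in> \<R>" "(\<lambda>x. x) \<in> rng_hom K A" "\<And>x. x \<in> carrier K \<Longrightarrow> r x = \<zero>\<^bsub>B\<^esub>"
      and ann: "\<And>n. annihilates n K \<and> annihilates n B \<Longrightarrow> annihilates n A"
      using kernel[OF Ob(1,2) r s] by blast
    \<comment> \<open>As \<open>r\<close> kills \<open>K\<close>, the inclusion and the zero map
      form a cone. The projection \<open>p\<close> is a left inverse of the induced map, so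
      \<open>K\<close> embeds into \<open>P\<close>.\<close>
    have "r x = f ((\<lambda>x \<in> carrier K. \<zero>\<^bsub>C\<^esub>) x)" if "x \<in> carrier K" for x
      using that K(3) rng_hom_zero[OF f] by simp
    then obtain u where "u \<in> rng_hom K P" "\<And>x. x \<in> carrier K \<Longrightarrow> p (u x) = x"
      by (rule pullback_induced[OF pb K(1,2) rng_hom_trivial[OF rng[OF K(1)] rngs(3)]])
      (assumption, rule that)
    from annihilates_left_inverse[OF rng[OF K(1)] this that(1)]
    show ?thesis using ann that(2) by blast
  qed
  ultimately show ?thesis by blast
qed

lemma retraction_full_rng:
  "retraction (full_rng \<R>) A B r \<Longrightarrow>
    \<exists>s. s \<in> rng_hom B A \<and> (\<forall>x \<in> carrier B. r (s x) = x)"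
  by (auto simp: retraction_def full_rng_simps compose_eq_id_iff)

lemma ring_char_iso:
  assumes "(A, B) \<in> iso_rel (full_rng \<R>)" shows "ring_char A = ring_char B"
proof -
  obtain f g where "A \<in> \<R>" "B \<in> \<R>"
    and f: "f \<in> rng_hom A B" "\<And>x. x \<in> carrier A \<Longrightarrow> g (f x) = x"
    and g: "g \<in> rng_hom B A" "\<And>x. x \<in> carrier B \<Longrightarrow> f (g x) = x"
    using assms by (auto simp: iso_rel_def isomorphic_def full_rng_simps compose_eq_id_iff)
  note rngs = this(1,2)[THEN rng]
  show ?thesis
    using annihilates_left_inverse[OF rngs(1) f] annihilates_left_inverse[OF rngs(2) g]
    by (intro ring_char_eqI rngs) blast
qed

lemma valued_dimension_full_rng: "valued_dimension lcm_monoid (full_rng \<R>) ring_char"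
proof (intro valued_dimension.intro comm_monoid_lcm_monoid category_full_rng
    valued_dimension_axioms.intro)
  show "ring_char \<in> Ob (full_rng \<R>) \<rightarrow> carrier lcm_monoid"
    by (simp add: lcm_monoid_def ring_char_nonzero)
  show "ring_char respects iso_rel (full_rng \<R>)"
    by (rule congruentI) (rule ring_char_iso)
  fix A B C r f P p q
  assume pb: "is_pullback (full_rng \<R>) A B C r f P p q" and r: "retraction (full_rng \<R>) A B r"
    and f: "retraction (full_rng \<R>) C B f \<or> coretraction (full_rng \<R>) C B f"
  have rngs: "rng P" "rng B" "rng A" "rng C"
    using pullback_full_rngD(1-4)[OF pb] by (simp_all add: rng)
  obtain s where s: "s \<in> rng_hom B A" "\<And>x. x \<in> carrier B \<Longrightarrow> r (s x) = x"
    using retraction_full_rng[OF r] by blast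
  have "annihilates n P \<and> annihilates n B \<longleftrightarrow> annihilates n A \<and> annihilates n C" for n
    using f
  proof
    assume "retraction (full_rng \<R>) C B f"
    then show ?thesis
      using retraction_full_rng annihilates_pullback_retraction[OF pb s] by blast
  next
    assume "coretraction (full_rng \<R>) C B f"
    then obtain g where g: "\<And>x. x \<in> carrier C \<Longrightarrow> g (f x) = x"
      by (auto simp: coretraction_def full_rng_simps compose_eq_id_iff)
    show ?thesis by (rule annihilates_pullback_coretraction[where g = g, OF pb s g])
  qed
  then show "ring_char P \<otimes>\<^bsub>lcm_monoid\<^esub> ring_char B = ring_char A \<otimes>\<^bsub>lcm_monoid\<^esub> ring_char C"
    using lcm_ring_char_eqI[OF rngs] by (simp add: lcm_monoid_def)
qed

end

section \<open>The kernel condition for \<open>Ring_n\<close> and \<open>Ring_1\<close>\<close>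

lemma rng_hom_a_inv:
  assumes "rng R" "rng S" "h \<in> rng_hom R S" "x \<in> carrier R"
  shows "h (\<ominus>\<^bsub>R\<^esub> x) = \<ominus>\<^bsub>S\<^esub> h x"
proof -
  interpret R: rng R by fact
  interpret S: rng S by fact
  have "h (\<ominus>\<^bsub>R\<^esub> x) \<oplus>\<^bsub>S\<^esub> h x = \<zero>\<^bsub>S\<^esub>"
    using assms(4) by (simp add: rng_hom_add[OF assms(3), symmetric] rng_hom_zero[OF assms(3)] R.l_neg)
  then show ?thesis
    using assms(4) by (intro S.minus_equality[symmetric]) (auto intro: rng_hom_closed[OF assms(3)])
qed

lemma add_pow_sum_eq_zero:
  fixes n :: nat
  assumes "rng R" "x \<in> carrier R" "y \<in> carrier R"
    and "[n] \<cdot>\<^bsub>R\<^esub> x = \<zero>\<^bsub>R\<^esub>" "[n] \<cdot>\<^bsub>R\<^esub> y = \<zero>\<^bsub>R\<^esub>"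
  shows "[n] \<cdot>\<^bsub>R\<^esub> (x \<oplus>\<^bsub>R\<^esub> y) = \<zero>\<^bsub>R\<^esub>"
proof -
  interpret R: rng R by fact
  show ?thesis using assms(2-) by (simp add: R.add.nat_pow_distrib)
qed

lemma annihilates_image:
  assumes "rng B" "s \<in> rng_hom B A" "annihilates n B" "x \<in> carrier B"
  shows "[n] \<cdot>\<^bsub>A\<^esub> s x = \<zero>\<^bsub>A\<^esub>"
  using assms rng_hom_add_pow[OF assms(1,2,4), of n] rng_hom_zero[OF assms(2)]
  by (simp add: annihilates_def)

lemma rng_zero_mult:
  assumes "rng R" "x \<in> carrier R"
  shows "\<zero>\<^bsub>R\<^esub> \<otimes>\<^bsub>R\<^esub> x = \<zero>\<^bsub>R\<^esub>" and "x \<otimes>\<^bsub>R\<^esub> \<zero>\<^bsub>R\<^esub> = \<zero>\<^bsub>R\<^esub>"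
proof -
  interpret R: rng R by fact
  show "\<zero>\<^bsub>R\<^esub> \<otimes>\<^bsub>R\<^esub> x = \<zero>\<^bsub>R\<^esub>"
    using R.rng_l_distr[of "\<zero>\<^bsub>R\<^esub>" "\<zero>\<^bsub>R\<^esub>" x] assms(2) by (simp add: R.rng_m_closed)
  show "x \<otimes>\<^bsub>R\<^esub> \<zero>\<^bsub>R\<^esub> = \<zero>\<^bsub>R\<^esub>"
    using R.rng_r_distr[of "\<zero>\<^bsub>R\<^esub>" "\<zero>\<^bsub>R\<^esub>" x] assms(2) by (simp add: R.rng_m_closed)
qed

lemma Ring_n_full: "Ring_n = full_rng {R. rng R}"
  by (simp add: full_rng_def Ring_n_def)

lemma Ring_1_full: "Ring_1 = full_rng {R. ring R}"
  by (simp add: full_rng_def Ring_1_def)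

text \<open>Here \<open>K\<close> is the whole kernel of \<open>r\<close>. Each \<open>x\<close> is
  the sum of \<open>x - s (r x)\<close>, which lies in \<open>K\<close> because
  \<open>r s = id\<close>, and \<open>s (r x)\<close>, which inherits annihilation from
  \<open>B\<close>.\<close>

lemma rng_full_subcategory_rng: "rng_full_subcategory {R. rng R}"
proof (rule rng_full_subcategory.intro)
  fix A B :: "'a ring" and r s
  assume "A \<in> {R. rng R}" "B \<in> {R. rng R}" and r: "r \<in> rng_hom A B" and s: "s \<in> rng_hom B A"
    and rs: "\<And>x. x \<in> carrier B \<Longrightarrow> r (s x) = x"
  then have A: "rng A" and B: "rng B" by auto
  interpret A: rng A by fact
  interpret B: rng B by fact
  define K where "K = A\<lparr>carrier := {x \<in> carrier A. r x = \<zero>\<^bsub>B\<^esub>}\<rparr>"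
  have K: "rng K"
    unfolding K_def by (rule subrng_rng[OF A])
      (auto simp: rng_hom_simps[OF r] rng_hom_a_inv[OF A B r] A.rng_m_closed rng_zero_mult[OF B])
  moreover have i: "(\<lambda>x. x) \<in> rng_hom K A"
    by (auto simp: rng_hom_def K_def)
  moreover have "annihilates n A" if K_B: "annihilates n K" "annihilates n B" for n
    unfolding annihilates_def
  proof
    fix x assume x: "x \<in> carrier A"
    note closed = rng_hom_closed[OF r x] rng_hom_closed[OF s rng_hom_closed[OF r x]]
    let ?y = "x \<oplus>\<^bsub>A\<^esub> \<ominus>\<^bsub>A\<^esub> s (r x)"
    have "?y \<in> carrier K"
      using x closed by (simp add: K_def rng_hom_add[OF r] rng_hom_a_inv[OF A B r] rs B.r_neg)
    moreover have "x = ?y \<oplus>\<^bsub>A\<^esub> s (r x)"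
      using x closed by (simp add: A.a_assoc A.l_neg)
    ultimately show "[n] \<cdot>\<^bsub>A\<^esub> x = \<zero>\<^bsub>A\<^esub>"
      using add_pow_sum_eq_zero[OF A _ closed(2) annihilates_image[OF K i K_B(1)]
          annihilates_image[OF B s K_B(2) closed(1)], of ?y] x closed
      by simp
  qed
  ultimately show "\<exists>K \<in> {R. rng R}. (\<lambda>x. x) \<in> rng_hom K A \<and> (\<forall>x \<in> carrier K. r x = \<zero>\<^bsub>B\<^esub>) \<and>
      (\<forall>n. annihilates n K \<and> annihilates n B \<longrightarrow> annihilates n A)"
    by (intro bexI[of _ K]) (auto simp: K_def)
qed (auto intro: rng_image)

text \<open>The multiple \<open>n x\<close> equals \<open>(n 1) x\<close>.\<close>

lemma annihilates_one_imp:
  assumes "ring R" "[n] \<cdot>\<^bsub>R\<^esub> \<one>\<^bsub>R\<^esub> = \<zero>\<^bsub>R\<^esub>" shows "annihilates n R"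
  unfolding annihilates_def
proof
  fix x assume x: "x \<in> carrier R"
  interpret R: ring R by fact
  have "[n] \<cdot>\<^bsub>R\<^esub> x = [n] \<cdot>\<^bsub>R\<^esub> \<one>\<^bsub>R\<^esub> \<otimes>\<^bsub>R\<^esub> x"
    using x by (simp add: R.add_pow_ldistr)
  then show "[n] \<cdot>\<^bsub>R\<^esub> x = \<zero>\<^bsub>R\<^esub>" using x assms(2) by simp
qed

text \<open>
  The corner ring \<open>\<kappa> A \<kappa>\<close> with \<open>\<kappa> = 1 - s 1\<close> is the unital substitute for the kernel of \<open>r\<close>:
  since \<open>1 = \<kappa> + s 1\<close>, the characteristic of \<open>A\<close> can be read off from it and \<open>B\<close>.
\<close>

lemma rng_full_subcategory_ring: "rng_full_subcategory {R. ring R}"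
proof (rule rng_full_subcategory.intro)
  fix A B :: "'a ring" and r s
  assume "A \<in> {R. ring R}" "B \<in> {R. ring R}" and r: "r \<in> rng_hom A B" and s: "s \<in> rng_hom B A"
    and rs: "\<And>x. x \<in> carrier B \<Longrightarrow> r (s x) = x"
  then have "ring A" "ring B" by auto
  note A = ring_imp_rng[OF \<open>ring A\<close>] and B = ring_imp_rng[OF \<open>ring B\<close>]
  interpret A: ring A by fact
  interpret B: ring B by fact
  let ?e = "s \<one>\<^bsub>B\<^esub>"
  define \<kappa> where "\<kappa> = \<one>\<^bsub>A\<^esub> \<oplus>\<^bsub>A\<^esub> \<ominus>\<^bsub>A\<^esub> ?e"
  have e: "?e \<in> carrier A" using rng_hom_closed[OF s] by simp
  \<comment> \<open>Since \<open>s\<close> need not preserve units, \<open>?e\<close> is only known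
    to be idempotent; its complement \<open>\<kappa>\<close> is then idempotent too.\<close>
  have ee: "?e \<otimes>\<^bsub>A\<^esub> ?e = ?e" by (simp add: rng_hom_mult[OF s, symmetric])
  have \<kappa>: "\<kappa> \<in> carrier A" using e by (simp add: \<kappa>_def)
  have one: "\<one>\<^bsub>A\<^esub> = \<kappa> \<oplus>\<^bsub>A\<^esub> ?e" using e by (simp add: \<kappa>_def A.a_assoc A.l_neg)
  have \<kappa>\<kappa>: "\<kappa> \<otimes>\<^bsub>A\<^esub> \<kappa> = \<kappa>"
    using e ee by (simp add: \<kappa>_def A.l_distr A.r_distr A.l_minus A.r_minus A.r_neg A.l_neg)
  \<comment> \<open>Although \<open>r\<close> is not assumed unital, it preserves the unit: multiply
    \<open>r 1\<close> by \<open>r (s 1) = 1\<close>.\<close>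
  have "r \<one>\<^bsub>A\<^esub> \<otimes>\<^bsub>B\<^esub> r ?e = r ?e"
    using rng_hom_mult[OF r A.one_closed e] e by simp
  then have "r \<one>\<^bsub>A\<^esub> = \<one>\<^bsub>B\<^esub>"
    using rs[OF B.one_closed] rng_hom_closed[OF r A.one_closed] by simp
  then have r\<kappa>: "r \<kappa> = \<zero>\<^bsub>B\<^esub>"
    using e rs by (simp add: \<kappa>_def rng_hom_add[OF r] rng_hom_a_inv[OF A B r] B.r_neg)
  \<comment> \<open>By idempotence these equations describe exactly the corner
    \<open>\<kappa> A \<kappa>\<close>.\<close>
  define H where "H = {x \<in> carrier A. \<kappa> \<otimes>\<^bsub>A\<^esub> x = x \<and> x \<otimes>\<^bsub>A\<^esub> \<kappa> = x}"
  \<comment> \<open>The unit of the corner is \<open>\<kappa>\<close>. If \<open>s\<close> happens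
    to be unital, then \<open>\<kappa> = 0\<close> and \<open>K\<close> is the zero ring, still an
    object.\<close>
  define K where "K = A\<lparr>carrier := H\<rparr>\<lparr>one := \<kappa>\<rparr>"
  have "rng (A\<lparr>carrier := H\<rparr>)"
    by (rule subrng_rng[OF A]) (use \<kappa> in \<open>auto simp: H_def A.l_distr A.r_distr A.l_minus A.r_minus
        A.m_assoc A.m_assoc[of \<kappa>, symmetric]\<close>)
  then have K: "ring K"
    unfolding K_def by (rule rng_with_unit_ring) (auto simp: H_def \<kappa> \<kappa>\<kappa>)
  moreover have i: "(\<lambda>x. x) \<in> rng_hom K A"
    by (auto simp: rng_hom_def K_def H_def)
  moreover have "r x = \<zero>\<^bsub>B\<^esub>" if "x \<in> carrier K" for x
  proof -
    have x: "x \<in> carrier A" "\<kappa> \<otimes>\<^bsub>A\<^esub> x = x" using that by (auto simp: K_def H_def)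
    have "r x = r \<kappa> \<otimes>\<^bsub>B\<^esub> r x" using rng_hom_mult[OF r \<kappa> x(1)] x(2) by simp
    then show ?thesis using r\<kappa> rng_hom_closed[OF r x(1)] by simp
  qed
  moreover have "annihilates n A" if K_B: "annihilates n K" "annihilates n B" for n
  proof (rule annihilates_one_imp[OF \<open>ring A\<close>])
    have "\<kappa> \<in> carrier K" by (simp add: K_def H_def \<kappa> \<kappa>\<kappa>)
    then show "[n] \<cdot>\<^bsub>A\<^esub> \<one>\<^bsub>A\<^esub> = \<zero>\<^bsub>A\<^esub>"
      unfolding one
      by (intro add_pow_sum_eq_zero[OF A \<kappa> e] annihilates_image[OF ring_imp_rng[OF K] i K_B(1)]
          annihilates_image[OF B s K_B(2)]) simp_all
  qed
  ultimately show "\<exists>K \<in> {R. ring R}. (\<lambda>x. x) \<in> rng_hom K A \<and> (\<forall>x \<in> carrier K. r x = \<zero>\<^bsub>B\<^esub>) \<and>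
      (\<forall>n. annihilates n K \<and> annihilates n B \<longrightarrow> annihilates n A)"
    by (intro bexI[of _ K]) auto
qed (auto intro: ring_image ring_imp_rng)


section \<open>Unital rings and unital homomorphisms\<close>

text \<open>Since \<open>n 1\<close> in \<open>S\<close> is the image of \<open>n 1\<close> in
  \<open>R\<close>, annihilation moves forward along a unital homomorphism, opposite to
  \<open>annihilates_inj\<close>.\<close>

lemma annihilates_unital:
  assumes "ring R" "ring S" "h \<in> rng_hom R S" "h \<in> ring_hom R S" "annihilates n R"
  shows "annihilates n S"
proof (rule annihilates_one_imp[OF assms(2)])
  interpret R: ring R by fact
  show "[n] \<cdot>\<^bsub>S\<^esub> \<one>\<^bsub>S\<^esub> = \<zero>\<^bsub>S\<^esub>"
    using annihilates_image[OF ring_imp_rng[OF assms(1)] assms(3,5) R.one_closed]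
    by (simp add: ring_hom_one[OF assms(4)])
qed

text \<open>The maps \<open>h\<close> and \<open>k\<close> need not be mutually inverse; each one
  transports annihilation in its own direction.\<close>

lemma ring_char_eq_unital:
  assumes "ring R" "ring S" "h \<in> Mor Ring_u R S" "k \<in> Mor Ring_u S R"
  shows "ring_char R = ring_char S"
proof (rule ring_char_eqI)
  fix n
  show "annihilates n R \<longleftrightarrow> annihilates n S"
    using assms annihilates_unital[of R S h n] annihilates_unital[of S R k n]
    by (auto simp: Ring_u_def Ring_1_def Ring_n_def)
qed (use assms ring_imp_rng in auto)

lemma Ring_u_simps:
  "Ob Ring_u = Ob Ring_1"
  "Mor Ring_u R S = Mor Ring_1 R S \<inter> ring_hom R S"
  "Idt Ring_u R = Idt Ring_1 R"
  "Comp Ring_u R S T g f = Comp Ring_1 R S T g f"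
  by (simp_all add: Ring_u_def)

lemma Ring_1_simps:
  "Ob Ring_1 = {R. ring R}"
  "Idt Ring_1 R = (\<lambda>x \<in> carrier R. x)"
  "Comp Ring_1 R S T g f = compose (carrier R) g f"
  by (simp_all add: Ring_1_def Ring_n_def)

text \<open>The laws are inherited from \<open>Ring_1\<close>; what is new is that identities are
  unital and that unital maps compose.\<close>

lemma category_Ring_u: "category (Ring_u :: ('a ring, 'a \<Rightarrow> 'a) category)"
proof -
  interpret category "Ring_1 :: ('a ring, 'a \<Rightarrow> 'a) category"
    unfolding Ring_1_full
    by (rule rng_full_subcategory.category_full_rng[OF rng_full_subcategory_ring])
  have "Idt Ring_1 A \<in> ring_hom A A" if "ring A" for A :: "'a ring"
    using that by (auto simp: ring_hom_def Ring_1_simps ring.ring_simprules)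
  moreover have "Comp Ring_1 A B C g f \<in> ring_hom A C"
    if "ring A" "f \<in> ring_hom A B" "g \<in> ring_hom B C" for A B C :: "'a ring" and f g
    using that by (auto simp: ring_hom_def Ring_1_simps ring.ring_simprules compose_eq Pi_iff)
  ultimately show ?thesis
    using Idt_closed Comp_closed Comp_Idt_right Comp_Idt_left Comp_assoc
    by unfold_locales (auto simp: Ring_u_simps Ring_1_simps(1))
qed

text \<open>
  Unital homomorphisms in both directions force equal characteristics, and \<open>C \<rightarrow> P\<close> is induced by
  \<open>s f\<close> and the identity; so all four characteristics agree.
\<close>

lemma valued_dimension_Ring_u:
  "valued_dimension lcm_monoid (Ring_u :: ('a ring, 'a \<Rightarrow> 'a) category) ring_char"
proof -
  interpret category "Ring_u :: ('a ring, 'a \<Rightarrow> 'a) category" by (rule category_Ring_u)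
  show ?thesis
  proof (intro valued_dimension.intro comm_monoid_lcm_monoid category_Ring_u
      valued_dimension_axioms.intro)
    show "ring_char \<in> Ob Ring_u \<rightarrow> carrier lcm_monoid"
      by (simp add: lcm_monoid_def ring_char_nonzero)
    show "ring_char respects (iso_rel Ring_u :: ('a ring \<times> 'a ring) set)"
      by (rule congruentI)
        (auto simp: iso_rel_def isomorphic_def Ring_u_simps(1) Ring_1_simps(1)
          intro: ring_char_eq_unital)
    fix A B C P :: "'a ring" and r f p q
    assume pb: "is_pullback Ring_u A B C r f P p q" and r: "retraction Ring_u A B r"
      and f: "retraction Ring_u C B f \<or> coretraction Ring_u C B f"
    \<comment> \<open>From the universal property, \<open>ex\<close> keeps only the existence of a
      map into \<open>P\<close>, which suffices for comparing characteristics.\<close>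
    have Ob: "A \<in> Ob Ring_u" "B \<in> Ob Ring_u" "C \<in> Ob Ring_u" "P \<in> Ob Ring_u"
      and fM: "f \<in> Mor Ring_u C B" and rM: "r \<in> Mor Ring_u A B" and qM: "q \<in> Mor Ring_u P C"
      and ex: "\<And>Q h k. Q \<in> Ob Ring_u \<Longrightarrow> h \<in> Mor Ring_u Q A \<Longrightarrow> k \<in> Mor Ring_u Q C \<Longrightarrow>
        Comp Ring_u Q A B r h = Comp Ring_u Q C B f k \<Longrightarrow> \<exists>u. u \<in> Mor Ring_u Q P"
      using pb unfolding is_pullback_def by (simp_all, blast)
    note rings = Ob[unfolded Ring_u_simps Ring_1_simps mem_Collect_eq]
    obtain s where s: "s \<in> Mor Ring_u B A" "Comp Ring_u B A B r s = Idt Ring_u B"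
      using r by (auto simp: retraction_def)
    \<comment> \<open>Whether \<open>f\<close> is a retraction or a section, its splitting is a
      unital map from \<open>B\<close> to \<open>C\<close>.\<close>
    obtain g where g: "g \<in> Mor Ring_u B C"
      using f by (auto simp: retraction_def coretraction_def)
    have "Comp Ring_u C A B r (Comp Ring_u C B A s f) = Comp Ring_u C C B f (Idt Ring_u C)"
      using Comp_assoc[OF Ob(3,2,1,2) fM s(1) rM] Ob fM
      by (simp add: s(2) Comp_Idt_left Comp_Idt_right)
    then obtain u where u: "u \<in> Mor Ring_u C P"
      using ex[OF Ob(3) Comp_closed[OF Ob(3,2,1) fM s(1)] Idt_closed[OF Ob(3)]] by blast
    show "ring_char P \<otimes>\<^bsub>lcm_monoid\<^esub> ring_char B
        = ring_char A \<otimes>\<^bsub>lcm_monoid\<^esub> ring_char C"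
      using ring_char_eq_unital[OF rings(1,2) rM s(1)] ring_char_eq_unital[OF rings(3,2) fM g]
        ring_char_eq_unital[OF rings(4,3) qM u]
      by simp
  qed
qed

theorem proposition6p6:
  shows "valued_dimension lcm_monoid (Ring_n :: ('a ring, 'a \<Rightarrow> 'a) category) ring_char \<and>
    valued_dimension lcm_monoid (Ring_1 :: ('a ring, 'a \<Rightarrow> 'a) category) ring_char \<and>
    valued_dimension lcm_monoid (Ring_u :: ('a ring, 'a \<Rightarrow> 'a) category) ring_char"
  by (intro conjI valued_dimension_Ring_u)
    (simp_all only: Ring_n_full Ring_1_full rng_full_subcategory.valued_dimension_full_rng
      rng_full_subcategory_rng rng_full_subcategory_ring)

end
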